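(* Let $X$ be a set and let $\mathcal{BR}(X)$ be the brace algebra of $X$-colored planar rooted trees. The coproduct $\Delta_F$ of Foissy's Hopf algebra of $X$-colored planar rooted trees is dual to the opposite of the product $*$ on $T(\mathcal{BR}(X))$: with respect to the pairing $\langle\ ,\ \rangle$ on $T(\mathcal{BR}(X))$ for which the basis of $X$-colored planar forests is orthonormal, for all $A,B,F\in T(\mathcal{BR}(X))$, $$\langle B*A,\,F\rangle=\langle A\otimes B,\ \Delta_F(F)\rangle ,$$ where $\langle A\otimes B,U\otimes V\rangle=\langle A,U\rangle\langle B,V\rangle$.
   Context: The base ring is a fixed commutative ring $\Bbbk$. Brace algebras. For a module $V$, $T(V)$ is the tensor module, with concatenation written by juxtaposition and with the deconcatenation coproduct $\Delta(X_1\cdots X_n)=\sum_{i=0}^n X_1\cdots X_i\otimes X_{i+1}\cdots X_n$, for which Sweedler notation is used. A brace algebra structure on $V$ is a linear map $V\otimes T(V)\to V$, $Y\otimes A\mapsto Y\{A\}$, with $Y\{1\}=Y$ and $Y\{Y_1\cdots Y_n\}\{A\}=Y\{A_{(1)}\,Y_1\{A_{(2)}\}\,A_{(3)}\cdots A_{(2n-1)}\,Y_n\{A_{(2n)}\}\,A_{(2n+1)}\}$. For a brace algebra $V$, the product $*$ on $T(V)$ is defined by induction by $1*B=B$ and $(YA)*B=B_{(1)}\,Y\{B_{(2)}\}\,(A*B_{(3)})$ for $Y\in V$, $A,B\in T(V)$. Planar trees. A planar rooted tree is a (finite) rooted tree in which, for every vertex, the set of its upgoing edges is totally ordered; it is $X$-colored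 if equipped with a map from its set of vertices to $X$. $\mathcal{BR}(X)$ is the free module on the $X$-colored planar rooted trees (up to isomorphism). The planar forests, i.e. the words $T_1\cdots T_n$ ($n\ge0$) in $X$-colored planar rooted trees, form a basis of $T(\mathcal{BR}(X))$. For $x\in X$, $\mathcal B_x^+:T(\mathcal{BR}(X))\to \mathcal{BR}(X)$ is the linear map sending a forest $T_1\cdots T_n$ to the planar tree obtained by adding a new root colored by $x$, joined to the roots of $T_1,\dots,T_n$ in this order. The brace algebra structure of $\mathcal{BR}(X)$ is the unique one such that $x\{T_1\cdots T_n\}=\mathcal B_x^+(T_1\cdots T_n)$ for all $x\in X$ (identified with the one-vertex tree colored by $x$) and all trees $T_1,\dots,T_n$; thus $\mathcal B_x^+(Y_1\cdots Y_k)\{A\}=\mathcal B_x^+(A_{(1)}\,Y_1\{A_{(2)}\}\,A_{(3)}\cdots Y_k\{A_{(2k)}\}\,A_{(2k+1)})$. Foissy's Hopf algebra is $T(\mathcal{BR}(X))$ with the concatenation product and the coproduct $\Delta_F$, which is the unique algebra morphism (for concatenation) such that, for every $x\in X$ and every forest $G$, $$\Delta_F(\mathcal B_x^+(G))=\mathcal B_x^+(G)\otimes 1+(\mathrm{id}\otimes\mathcal B_x^+)\Delta_F(G).$$ *)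

theory Defs
  imports "HOL.Modules" "HOL-Library.Poly_Mapping" "HOL-Library.Product_Plus"
begin

section \<open>Free modules and tensor modules\<close>

text \<open>
  The free module over a commutative ring \<open>'k\<close> with basis \<open>'b\<close> is the type \<open>'b \<Rightarrow>\<^sub>0 'k\<close> of finitely
  supported functions. The tensor product of the free modules on \<open>'b\<close> and \<open>'c\<close> is the free module on
  \<open>'b \<times> 'c\<close>, and the tensor module of the free module on \<open>'b\<close> is the free module on the words
  \<open>'b list\<close>.
\<close>

definition scal :: "'k \<Rightarrow> ('b \<Rightarrow>\<^sub>0 'k) \<Rightarrow> ('b \<Rightarrow>\<^sub>0 'k::comm_ring_1)" where
  "scal c p = Poly_Mapping.map ((*) c) p"

definition bvec :: "'b \<Rightarrow> ('b \<Rightarrow>\<^sub>0 'k::comm_ring_1)" where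
  "bvec b = Poly_Mapping.single b 1"

abbreviation lin_map :: "(('b \<Rightarrow>\<^sub>0 'k::comm_ring_1) \<Rightarrow> ('c \<Rightarrow>\<^sub>0 'k)) \<Rightarrow> bool" where
  "lin_map f \<equiv> module_hom scal scal f"

definition linext :: "('b \<Rightarrow> ('c \<Rightarrow>\<^sub>0 'k)) \<Rightarrow> ('b \<Rightarrow>\<^sub>0 'k::comm_ring_1) \<Rightarrow> ('c \<Rightarrow>\<^sub>0 'k)" where
  "linext f p = (\<Sum>b\<in>Poly_Mapping.keys p. scal (Poly_Mapping.lookup p b) (f b))"

definition tens :: "('b \<Rightarrow>\<^sub>0 'k) \<Rightarrow> ('c \<Rightarrow>\<^sub>0 'k) \<Rightarrow> ('b \<times> 'c \<Rightarrow>\<^sub>0 'k::comm_ring_1)" where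
  "tens p q = linext (\<lambda>u. linext (\<lambda>v. bvec (u, v)) q) p"

definition tens_map ::
  "(('b \<Rightarrow>\<^sub>0 'k) \<Rightarrow> ('d \<Rightarrow>\<^sub>0 'k)) \<Rightarrow> (('c \<Rightarrow>\<^sub>0 'k) \<Rightarrow> ('e \<Rightarrow>\<^sub>0 'k)) \<Rightarrow>
    ('b \<times> 'c \<Rightarrow>\<^sub>0 'k) \<Rightarrow> ('d \<times> 'e \<Rightarrow>\<^sub>0 'k::comm_ring_1)" where
  "tens_map f g = linext (\<lambda>(u, v). tens (f (bvec u)) (g (bvec v)))"

text \<open>The bilinear pairing for which the given basis is orthonormal.\<close>

definition pairing :: "('b \<Rightarrow>\<^sub>0 'k) \<Rightarrow> ('b \<Rightarrow>\<^sub>0 'k) \<Rightarrow> 'k::comm_ring_1" where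
  "pairing p q = (\<Sum>b\<in>Poly_Mapping.keys p. Poly_Mapping.lookup p b * Poly_Mapping.lookup q b)"

text \<open>
  Words form a monoid under concatenation, so the convolution product \<open>*\<close> which \<open>\<Rightarrow>\<^sub>0\<close> carries over a
  monoid is the concatenation product of the tensor module, with unit \<open>1 = bvec []\<close>; on the free
  module on pairs of words it is the product of the tensor square of that algebra.
\<close>

instantiation list :: (type) monoid_add
begin

definition zero_list_def: "0 = []"

definition plus_list_def: "u + v = u @ v"

instance
  by standard (simp_all add: zero_list_def plus_list_def)

end

definition letter :: "('b \<Rightarrow>\<^sub>0 'k) \<Rightarrow> ('b list \<Rightarrow>\<^sub>0 'k::comm_ring_1)" where
  "letter = linext (\<lambda>b. bvec [b])"

text \<open>
  For trilinear \<open>f\<close>, \<open>sweedler3 A f\<close> is \<open>f A\<^bsub>(1)\<^esub> A\<^bsub>(2)\<^esub> A\<^bsub>(3)\<^esub>\<close> in Sweedler notation for the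
  deconcatenation coproduct.
\<close>

definition sweedler3 ::
  "('b list \<Rightarrow>\<^sub>0 'k) \<Rightarrow>
    (('b list \<Rightarrow>\<^sub>0 'k) \<Rightarrow> ('b list \<Rightarrow>\<^sub>0 'k) \<Rightarrow> ('b list \<Rightarrow>\<^sub>0 'k) \<Rightarrow> ('c \<Rightarrow>\<^sub>0 'k)) \<Rightarrow>
    ('c \<Rightarrow>\<^sub>0 'k::comm_ring_1)" where
  "sweedler3 A f =
    linext (\<lambda>w. \<Sum>(a, b, c)\<in>{(a, b, c). a @ b @ c = w}. f (bvec a) (bvec b) (bvec c)) A"


section \<open>Brace algebras\<close>

text \<open>
  \<open>brace_insert br [Y\<^sub>1, \<dots>, Y\<^sub>n] A\<close> is
  \<open>A\<^bsub>(1)\<^esub> Y\<^sub>1{A\<^bsub>(2)\<^esub>} A\<^bsub>(3)\<^esub> \<dots> A\<^bsub>(2n-1)\<^esub> Y\<^sub>n{A\<^bsub>(2n)\<^esub>} A\<^bsub>(2n+1)\<^esub>\<close>; by coassociativity the Sweedler components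
  may be split off two at a time.
\<close>

fun brace_insert ::
  "(('b \<Rightarrow>\<^sub>0 'k) \<Rightarrow> ('b list \<Rightarrow>\<^sub>0 'k) \<Rightarrow> ('b \<Rightarrow>\<^sub>0 'k)) \<Rightarrow>
    ('b \<Rightarrow>\<^sub>0 'k) list \<Rightarrow> ('b list \<Rightarrow>\<^sub>0 'k) \<Rightarrow> ('b list \<Rightarrow>\<^sub>0 'k::comm_ring_1)" where
  "brace_insert br [] A = A"
| "brace_insert br (Y # Ys) A =
    sweedler3 A (\<lambda>A1 A2 A3. A1 * letter (br Y A2) * brace_insert br Ys A3)"

definition brace_algebra ::
  "(('b \<Rightarrow>\<^sub>0 'k) \<Rightarrow> ('b list \<Rightarrow>\<^sub>0 'k) \<Rightarrow> ('b \<Rightarrow>\<^sub>0 'k::comm_ring_1)) \<Rightarrow> bool" where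
  "brace_algebra br \<longleftrightarrow>
    (\<forall>Y. lin_map (br Y)) \<and> (\<forall>A. lin_map (\<lambda>Y. br Y A)) \<and>
    (\<forall>Y. br Y 1 = Y) \<and>
    (\<forall>Y Ys A. br (br Y (prod_list (map letter Ys))) A = br Y (brace_insert br Ys A))"

text \<open>The product \<open>*\<close> on the tensor module of a brace algebra.\<close>

fun star_word ::
  "(('b \<Rightarrow>\<^sub>0 'k) \<Rightarrow> ('b list \<Rightarrow>\<^sub>0 'k) \<Rightarrow> ('b \<Rightarrow>\<^sub>0 'k)) \<Rightarrow>
    'b list \<Rightarrow> ('b list \<Rightarrow>\<^sub>0 'k) \<Rightarrow> ('b list \<Rightarrow>\<^sub>0 'k::comm_ring_1)" where
  "star_word br [] B = B"
| "star_word br (y # w) B =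
    sweedler3 B (\<lambda>B1 B2 B3. B1 * letter (br (bvec y) B2) * star_word br w B3)"

definition star ::
  "(('b \<Rightarrow>\<^sub>0 'k) \<Rightarrow> ('b list \<Rightarrow>\<^sub>0 'k) \<Rightarrow> ('b \<Rightarrow>\<^sub>0 'k)) \<Rightarrow>
    ('b list \<Rightarrow>\<^sub>0 'k) \<Rightarrow> ('b list \<Rightarrow>\<^sub>0 'k) \<Rightarrow> ('b list \<Rightarrow>\<^sub>0 'k::comm_ring_1)" where
  "star br A B = linext (\<lambda>w. star_word br w B) A"


section \<open>Planar trees\<close>

datatype 'x ptree = Node 'x "'x ptree list"

type_synonym 'x pforest = "'x ptree list"

definition Bplus :: "'x \<Rightarrow> ('x pforest \<Rightarrow>\<^sub>0 'k) \<Rightarrow> ('x ptree \<Rightarrow>\<^sub>0 'k::comm_ring_1)" where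
  "Bplus x = linext (\<lambda>G. bvec (Node x G))"

text \<open>
  The recursion follows the brace identity for \<open>B\<^sub>x\<^sup>+(Y\<^sub>1 \<dots> Y\<^sub>k) = x{Y\<^sub>1 \<dots> Y\<^sub>k}\<close>; by \<open>brace_unique\<close> below,
  \<open>brace\<close> is the only brace algebra structure with \<open>x{G} = B\<^sub>x\<^sup>+(G)\<close>. Likewise, \<open>foissy_unique\<close>
  characterizes \<open>foissy\<close> as an algebra morphism.
\<close>

fun brace_tree :: "'x ptree \<Rightarrow> ('x pforest \<Rightarrow>\<^sub>0 'k) \<Rightarrow> ('x ptree \<Rightarrow>\<^sub>0 'k::comm_ring_1)"
and brace_forest :: "'x pforest \<Rightarrow> ('x pforest \<Rightarrow>\<^sub>0 'k) \<Rightarrow> ('x pforest \<Rightarrow>\<^sub>0 'k::comm_ring_1)" where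
  "brace_tree (Node x Ys) A = Bplus x (brace_forest Ys A)"
| "brace_forest [] A = A"
| "brace_forest (Y # Ys) A =
    sweedler3 A (\<lambda>A1 A2 A3. A1 * letter (brace_tree Y A2) * brace_forest Ys A3)"

definition brace :: "('x ptree \<Rightarrow>\<^sub>0 'k) \<Rightarrow> ('x pforest \<Rightarrow>\<^sub>0 'k) \<Rightarrow> ('x ptree \<Rightarrow>\<^sub>0 'k::comm_ring_1)" where
  "brace Y A = linext (\<lambda>T. brace_tree T A) Y"

fun foissy_tree :: "'x ptree \<Rightarrow> ('x pforest \<times> 'x pforest \<Rightarrow>\<^sub>0 'k::comm_ring_1)"
and foissy_forest :: "'x pforest \<Rightarrow> ('x pforest \<times> 'x pforest \<Rightarrow>\<^sub>0 'k::comm_ring_1)" where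
  "foissy_tree (Node x G) =
    tens (bvec [Node x G]) 1 + tens_map id (\<lambda>V. letter (Bplus x V)) (foissy_forest G)"
| "foissy_forest [] = 1"
| "foissy_forest (T # G) = foissy_tree T * foissy_forest G"

definition foissy :: "('x pforest \<Rightarrow>\<^sub>0 'k) \<Rightarrow> ('x pforest \<times> 'x pforest \<Rightarrow>\<^sub>0 'k::comm_ring_1)" where
  "foissy = linext foissy_forest"


section \<open>Basic facts\<close>

lemma lookup_scal: "Poly_Mapping.lookup (scal c p) b = c * Poly_Mapping.lookup p b"
  by (simp add: scal_def Poly_Mapping.map.rep_eq when_def)

lemma module_scal: "module scal"
  by unfold_locales (auto intro!: poly_mapping_eqI simp: lookup_scal lookup_add algebra_simps)

interpretation scal: module scal
  by (rule module_scal)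

lemma lin_mapI:
  "(\<And>p q. f (p + q) = f p + f q) \<Longrightarrow> (\<And>c p. f (scal c p) = scal c (f p)) \<Longrightarrow> lin_map f"
  by (simp add: module_hom_def module_hom_axioms_def module_scal)

lemma lin_map_add: "lin_map f \<Longrightarrow> f (p + q) = f p + f q"
  by (simp add: module_hom_def module_hom_axioms_def)

lemma lin_map_scal: "lin_map f \<Longrightarrow> f (scal c p) = scal c (f p)"
  by (simp add: module_hom_def module_hom_axioms_def)

lemma lin_map_sum: "lin_map f \<Longrightarrow> f (\<Sum>i\<in>I. g i) = (\<Sum>i\<in>I. f (g i))"
  by (rule module_hom.sum)

lemma linext_superset:
  assumes "finite S" "Poly_Mapping.keys p \<subseteq> S"
  shows "linext f p = (\<Sum>b\<in>S. scal (Poly_Mapping.lookup p b) (f b))"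
  unfolding linext_def using assms
  by (intro sum.mono_neutral_left) (auto simp: in_keys_iff)

lemma lin_linext:
  fixes f :: "'b \<Rightarrow> ('c \<Rightarrow>\<^sub>0 'k::comm_ring_1)"
  shows "lin_map (linext f)"
proof (rule lin_mapI)
  fix p q :: "'b \<Rightarrow>\<^sub>0 'k"
  let ?S = "Poly_Mapping.keys p \<union> Poly_Mapping.keys q"
  have "Poly_Mapping.keys (p + q) \<subseteq> ?S" by (rule Poly_Mapping.keys_add)
  then show "linext f (p + q) = linext f p + linext f q"
    by (simp add: linext_superset[of ?S] lookup_add scal.scale_left_distrib sum.distrib)
next
  fix c and p :: "'b \<Rightarrow>\<^sub>0 'k"
  have "Poly_Mapping.keys (scal c p) \<subseteq> Poly_Mapping.keys p"
    by (auto simp: in_keys_iff lookup_scal)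
  then show "linext f (scal c p) = scal c (linext f p)"
    by (simp add: linext_superset[of "Poly_Mapping.keys p"] lookup_scal scal.scale_sum_right)
qed

lemma linext_bvec [simp]: "linext f (bvec b) = f b"
  by (simp add: linext_def bvec_def)

lemma linext_bvec_id: "linext bvec p = p"
proof (rule poly_mapping_eqI)
  fix b
  have "Poly_Mapping.lookup (linext bvec p) b =
      (\<Sum>a\<in>Poly_Mapping.keys p. Poly_Mapping.lookup p a * (1 when a = b))"
    by (simp add: linext_def lookup_sum lookup_scal bvec_def lookup_single)
  also have "\<dots> = (\<Sum>a\<in>Poly_Mapping.keys p. if a = b then Poly_Mapping.lookup p a else 0)"
    by (intro sum.cong) (auto simp: when_def)
  also have "\<dots> = Poly_Mapping.lookup p b"
    by (simp add: in_keys_iff)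
  finally show "Poly_Mapping.lookup (linext bvec p) b = Poly_Mapping.lookup p b" .
qed

lemma lin_map_linext: "lin_map h \<Longrightarrow> h (linext f p) = linext (\<lambda>b. h (f b)) p"
  by (simp add: linext_def lin_map_sum lin_map_scal)

lemma lin_map_eqI:
  assumes "lin_map f" "lin_map g" "\<And>b. f (bvec b) = g (bvec b)"
  shows "f p = g p"
proof -
  have "f p = linext (\<lambda>b. f (bvec b)) p"
    using lin_map_linext[OF assms(1), of bvec p] by (simp add: linext_bvec_id)
  also have "\<dots> = linext (\<lambda>b. g (bvec b)) p" by (simp add: assms(3))
  also have "\<dots> = g p"
    using lin_map_linext[OF assms(2), of bvec p] by (simp add: linext_bvec_id)
  finally show ?thesis .
qed

lemma lin_compose: "lin_map f \<Longrightarrow> lin_map g \<Longrightarrow> lin_map (\<lambda>x. f (g x))"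
  by (rule lin_mapI) (simp_all add: lin_map_add lin_map_scal)

lemma lin_ident: "lin_map (\<lambda>x. x)"
  by (rule lin_mapI) simp_all

lemma lin_add: "lin_map f \<Longrightarrow> lin_map g \<Longrightarrow> lin_map (\<lambda>x. f x + g x)"
  by (rule lin_mapI) (simp_all add: lin_map_add lin_map_scal scal.scale_right_distrib)

lemma lin_scal: "lin_map f \<Longrightarrow> lin_map (\<lambda>x. scal c (f x))"
  by (rule lin_mapI)
    (simp_all add: lin_map_add lin_map_scal scal.scale_right_distrib mult.commute)

lemma lin_sum: "(\<And>i. i \<in> I \<Longrightarrow> lin_map (f i)) \<Longrightarrow> lin_map (\<lambda>x. \<Sum>i\<in>I. f i x)"
  by (rule lin_mapI) (simp_all add: lin_map_add lin_map_scal sum.distrib scal.scale_sum_right)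

lemma lin_linext_param: "(\<And>b. lin_map (f b)) \<Longrightarrow> lin_map (\<lambda>x. linext (\<lambda>b. f b x) p)"
  unfolding linext_def by (intro lin_sum lin_scal)

lemma scal_mult_left: "scal c p * q = scal c (p * q)"
  for p q :: "'b::monoid_add \<Rightarrow>\<^sub>0 'k::comm_ring_1"
  by (simp add: scal_def mult_map_scale_conv_mult mult.assoc)

lemma scal_mult_right: "p * scal c q = scal c (p * q)"
  for p q :: "'b::monoid_add \<Rightarrow>\<^sub>0 'k::comm_ring_1"
proof -
  have sgl: "bvec b * Poly_Mapping.single 0 c = scal c (bvec b)" for b :: 'b
    by (simp add: bvec_def scal_def mult_single)
  have "p * Poly_Mapping.single 0 c = linext bvec p * Poly_Mapping.single 0 c"
    by (simp add: linext_bvec_id)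
  also have "\<dots> = linext (\<lambda>b. bvec b * Poly_Mapping.single 0 c) p"
    by (simp add: linext_def sum_distrib_right scal_mult_left)
  also have "\<dots> = scal c (linext bvec p)"
    by (simp add: sgl linext_def scal.scale_sum_right mult.commute)
  finally have "p * Poly_Mapping.single 0 c = scal c p"
    by (simp add: linext_bvec_id)
  moreover have "scal c q = Poly_Mapping.single 0 c * q"
    by (simp add: scal_def mult_map_scale_conv_mult)
  ultimately show ?thesis
    by (simp add: mult.assoc[symmetric] scal_mult_left)
qed

lemma lin_mult_left: "lin_map f \<Longrightarrow> lin_map (\<lambda>x. f x * q)"
  for q :: "'b::monoid_add \<Rightarrow>\<^sub>0 'k::comm_ring_1"
  by (rule lin_mapI) (simp_all add: lin_map_add lin_map_scal distrib_right scal_mult_left)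

lemma lin_mult_right: "lin_map f \<Longrightarrow> lin_map (\<lambda>x. q * f x)"
  for q :: "'b::monoid_add \<Rightarrow>\<^sub>0 'k::comm_ring_1"
  by (rule lin_mapI) (simp_all add: lin_map_add lin_map_scal distrib_left scal_mult_right)

lemma bvec_mult: "bvec u * bvec v = bvec (u + v)"
  by (simp add: bvec_def mult_single)

lemma bvec_append: "bvec u * bvec v = bvec (u @ v)"
  by (simp add: bvec_mult plus_list_def)

lemma bvec_Nil: "bvec [] = 1"
  by (simp add: bvec_def single_one[symmetric] zero_list_def del: single_one)

lemma lin_letter: "lin_map letter"
  unfolding letter_def by (rule lin_linext)

lemma letter_bvec [simp]: "letter (bvec b) = bvec [b]"
  by (simp add: letter_def)

lemma lin_Bplus: "lin_map (Bplus x)"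
  unfolding Bplus_def by (rule lin_linext)

lemma Bplus_bvec [simp]: "Bplus x (bvec G) = bvec (Node x G)"
  by (simp add: Bplus_def)

lemma tens_bvec [simp]: "tens (bvec u) (bvec v) = bvec (u, v)"
  by (simp add: tens_def)

lemma lookup_tens: "Poly_Mapping.lookup (tens p q) (u, v) = Poly_Mapping.lookup p u * Poly_Mapping.lookup q v"
proof -
  have inner: "Poly_Mapping.lookup (linext (\<lambda>v. bvec (a, v)) q) (u, v) =
      (if a = u then Poly_Mapping.lookup q v else 0)" for a
  proof -
    have "Poly_Mapping.lookup (linext (\<lambda>v. bvec (a, v)) q) (u, v) =
        (\<Sum>b\<in>Poly_Mapping.keys q. if b = v then (if a = u then Poly_Mapping.lookup q b else 0) else 0)"
      unfolding linext_def lookup_sum lookup_scal bvec_def lookup_single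
      by (intro sum.cong) (auto simp: when_def)
    also have "\<dots> = (if a = u then Poly_Mapping.lookup q v else 0)"
      by (simp add: in_keys_iff)
    finally show ?thesis .
  qed
  have "Poly_Mapping.lookup (tens p q) (u, v) = (\<Sum>a\<in>Poly_Mapping.keys p.
      if a = u then Poly_Mapping.lookup p a * Poly_Mapping.lookup q v else 0)"
    unfolding tens_def linext_def[of _ p] lookup_sum lookup_scal inner by (intro sum.cong) auto
  also have "\<dots> = Poly_Mapping.lookup p u * Poly_Mapping.lookup q v"
    by (simp add: in_keys_iff)
  finally show ?thesis .
qed

lemma pairing_bvec: "pairing (bvec a) (bvec b) = (if a = b then 1 else 0)"
  by (simp add: pairing_def bvec_def lookup_single when_def)

lemma pairing_tens:
  "pairing (tens A B) (tens U V) = pairing A U * pairing B V"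
proof -
  let ?S = "Poly_Mapping.keys A \<times> Poly_Mapping.keys B"
  have "Poly_Mapping.keys (tens A B) \<subseteq> ?S"
    by (auto simp: in_keys_iff lookup_tens)
  then have "pairing (tens A B) (tens U V) =
      (\<Sum>b\<in>?S. Poly_Mapping.lookup (tens A B) b * Poly_Mapping.lookup (tens U V) b)"
    unfolding pairing_def by (intro sum.mono_neutral_left) (auto simp: in_keys_iff)
  also have "\<dots> = pairing A U * pairing B V"
    by (auto simp: pairing_def sum_product sum.cartesian_product lookup_tens mult.assoc
        mult.left_commute intro!: sum.cong)
  finally show ?thesis .
qed


section \<open>Deconcatenation\<close>

definition dec2 :: "'b list \<Rightarrow> ('b list \<Rightarrow> 'b list \<Rightarrow> 'm) \<Rightarrow> 'm::comm_monoid_add" where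
  "dec2 w f = (\<Sum>(a, b)\<in>{(a, b). a @ b = w}. f a b)"

lemma splits_Cons:
  "{(a, b). a @ b = x # w} = insert ([], x # w) ((\<lambda>(a, b). (x # a, b)) ` {(a, b). a @ b = w})"
  by (auto simp: append_eq_Cons_conv image_iff)

lemma finite_splits: "finite {(a, b). a @ b = w}"
  by (induction w) (simp_all add: splits_Cons)

lemma dec2_Nil [simp]: "dec2 [] f = f [] []"
proof -
  have "{(a, b). a @ b = []} = {([], [])}" by auto
  then show ?thesis by (simp add: dec2_def)
qed

lemma dec2_Cons [simp]: "dec2 (x # w) f = f [] (x # w) + dec2 w (\<lambda>a b. f (x # a) b)"
proof -
  have "inj_on (\<lambda>(a, b). (x # a, b)) {(a, b). a @ b = w}"
    by (auto simp: inj_on_def)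
  moreover have "([], x # w) \<notin> (\<lambda>(a, b). (x # a, b)) ` {(a, b). a @ b = w}"
    by auto
  ultimately show ?thesis
    unfolding dec2_def splits_Cons
    by (subst sum.insert) (use finite_splits[of w] in
        \<open>auto simp: sum.reindex case_prod_unfold comp_def\<close>)
qed

lemma dec2_distrib: "dec2 w (\<lambda>a b. f a b + g a b) = dec2 w f + dec2 w g"
  by (simp add: dec2_def sum.distrib case_prod_unfold)

lemma dec2_zero: "dec2 w (\<lambda>a b. 0) = 0"
  by (simp add: dec2_def)

lemma dec2_swap: "dec2 u (\<lambda>a b. dec2 v (\<lambda>c d. f a b c d)) = dec2 v (\<lambda>c d. dec2 u (\<lambda>a b. f a b c d))"
  unfolding dec2_def case_prod_unfold by (rule sum.swap)

lemma dec2_assoc: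
  "dec2 w (\<lambda>a r. dec2 r (\<lambda>b c. f a b c)) = dec2 w (\<lambda>l c. dec2 l (\<lambda>a b. f a b c))"
  by (induction w arbitrary: f) (simp_all add: dec2_distrib add.assoc)

lemma dec2_append_letter:
  "dec2 (a @ t # z) g = dec2 a (\<lambda>p q. g p (q @ t # z)) + dec2 z (\<lambda>p q. g (a @ t # p) q)"
  by (induction a arbitrary: g) (simp_all add: add.assoc)

lemma sum_splits3:
  "(\<Sum>(a, b, c)\<in>{(a, b, c). a @ b @ c = w}. f a b c) = dec2 w (\<lambda>a r. dec2 r (\<lambda>b c. f a b c))"
proof -
  have "dec2 w (\<lambda>a r. dec2 r (\<lambda>b c. f a b c)) =
      (\<Sum>(p, q)\<in>Sigma {(a, r). a @ r = w} (\<lambda>p. {(b, c). b @ c = snd p}). f (fst p) (fst q) (snd q))"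
    using sum.Sigma[of "{(a, r). a @ r = w}" "\<lambda>p. {(b, c). b @ c = snd p}"
        "\<lambda>p q. f (fst p) (fst q) (snd q)"]
    by (simp add: dec2_def case_prod_unfold finite_splits[unfolded case_prod_unfold])
  also have "\<dots> = (\<Sum>(a, b, c)\<in>{(a, b, c). a @ b @ c = w}. f a b c)"
    by (rule sum.reindex_bij_witness[where
          i = "\<lambda>(a, b, c). ((a, b @ c), (b, c))" and j = "\<lambda>(p, q). (fst p, fst q, snd q)"]) auto
  finally show ?thesis by simp
qed

lemma lin_map_dec2: "lin_map h \<Longrightarrow> h (dec2 w f) = dec2 w (\<lambda>a b. h (f a b))"
  by (simp add: dec2_def lin_map_sum case_prod_unfold)

lemma lin_dec2: "(\<And>a b. lin_map (f a b)) \<Longrightarrow> lin_map (\<lambda>x. dec2 w (\<lambda>a b. f a b x))"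
  unfolding dec2_def case_prod_unfold by (rule lin_sum) simp

definition sweedler2 ::
  "('b list \<Rightarrow>\<^sub>0 'k) \<Rightarrow>
    (('b list \<Rightarrow>\<^sub>0 'k) \<Rightarrow> ('b list \<Rightarrow>\<^sub>0 'k) \<Rightarrow> ('c \<Rightarrow>\<^sub>0 'k)) \<Rightarrow> ('c \<Rightarrow>\<^sub>0 'k::comm_ring_1)" where
  "sweedler2 A f = linext (\<lambda>w. dec2 w (\<lambda>a b. f (bvec a) (bvec b))) A"

lemma sweedler2_bvec [simp]: "sweedler2 (bvec w) f = dec2 w (\<lambda>a b. f (bvec a) (bvec b))"
  by (simp add: sweedler2_def)

lemma sweedler3_bvec [simp]:
  "sweedler3 (bvec w) f = dec2 w (\<lambda>a r. dec2 r (\<lambda>b c. f (bvec a) (bvec b) (bvec c)))"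
  by (simp add: sweedler3_def sum_splits3)

lemma lin_sweedler2: "lin_map (\<lambda>A. sweedler2 A f)"
  unfolding sweedler2_def by (rule lin_linext)

lemma lin_sweedler3: "lin_map (\<lambda>A. sweedler3 A f)"
  unfolding sweedler3_def by (rule lin_linext)

lemma lin_sweedler2_param: "(\<And>p q. lin_map (f p q)) \<Longrightarrow> lin_map (\<lambda>x. sweedler2 A (\<lambda>p q. f p q x))"
  unfolding sweedler2_def by (intro lin_linext_param lin_dec2)

lemma lin_sweedler3_param:
  "(\<And>p q r. lin_map (f p q r)) \<Longrightarrow> lin_map (\<lambda>x. sweedler3 A (\<lambda>p q r. f p q r x))"
  unfolding sweedler3_def sum_splits3 by (intro lin_linext_param lin_dec2)

lemma sweedler3_eq: "sweedler3 A f = sweedler2 A (\<lambda>p r. sweedler2 r (\<lambda>q s. f p q s))"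
  by (rule lin_map_eqI[of "\<lambda>A. sweedler3 A f"]) (simp_all add: lin_sweedler2 lin_sweedler3)


section \<open>The brace structure on planar trees\<close>

definition bilin ::
  "(('b \<Rightarrow>\<^sub>0 'k) \<Rightarrow> ('c \<Rightarrow>\<^sub>0 'k) \<Rightarrow> ('d \<Rightarrow>\<^sub>0 'k::comm_ring_1)) \<Rightarrow> bool" where
  "bilin f \<longleftrightarrow> (\<forall>x. lin_map (f x)) \<and> (\<forall>y. lin_map (\<lambda>x. f x y))"

lemma bilinI: "(\<And>x. lin_map (f x)) \<Longrightarrow> (\<And>y. lin_map (\<lambda>x. f x y)) \<Longrightarrow> bilin f"
  by (simp add: bilin_def)

lemma bilin_left: "bilin f \<Longrightarrow> lin_map g \<Longrightarrow> lin_map (\<lambda>x. f (g x) y)"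
  using lin_compose[of "\<lambda>x. f x y" g] by (simp add: bilin_def)

lemma bilin_right: "bilin f \<Longrightarrow> lin_map g \<Longrightarrow> lin_map (\<lambda>x. f y (g x))"
  using lin_compose[of "f y" g] by (simp add: bilin_def)

lemmas lin_letter' = lin_compose[OF lin_letter]

lemma lin_star_word: "lin_map (star_word br w)"
proof (cases w)
  case Nil
  then have "star_word br w = (\<lambda>B. B)" by (intro ext) simp
  then show ?thesis by (simp add: lin_ident)
next
  case (Cons y u)
  then have "star_word br w =
      (\<lambda>B. sweedler3 B (\<lambda>B1 B2 B3. B1 * letter (br (bvec y) B2) * star_word br u B3))"
    by (intro ext) simp
  then show ?thesis by (simp add: lin_sweedler3)
qed

lemma bilin_star: "bilin (star br)"
  unfolding star_def
  by (intro bilinI lin_linext lin_linext_param lin_star_word)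

lemma star_bvec: "star br (bvec w) B = star_word br w B"
  by (simp add: star_def)

lemma star_one [simp]: "star br 1 B = B"
  by (simp add: bvec_Nil[symmetric] star_bvec)

lemma star_letter_mult:
  assumes "bilin br"
  shows "star br (letter Y * P) B = sweedler3 B (\<lambda>B1 B2 B3. B1 * letter (br Y B2) * star br P B3)"
proof -
  note li = lin_sweedler3_param lin_mult_left lin_mult_right bilin_left[OF assms] lin_ident
    bilin_left[OF bilin_star] lin_letter'
  have 1: "star br (letter (bvec y) * P) B =
      sweedler3 B (\<lambda>B1 B2 B3. B1 * letter (br (bvec y) B2) * star br P B3)" for y
    by (rule lin_map_eqI[of "\<lambda>P. star br (letter (bvec y) * P) B"])
      (auto intro!: li simp: bvec_append star_bvec)
  show ?thesis
    by (rule lin_map_eqI[of "\<lambda>Y. star br (letter Y * P) B"]) (auto intro!: li simp: 1 simp del: letter_bvec)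
qed

lemma brace_insert_eq_star:
  assumes "bilin br"
  shows "brace_insert br Ys A = star br (prod_list (map letter Ys)) A"
  by (induction Ys arbitrary: A) (simp_all add: star_letter_mult[OF assms])

lemma prod_list_letters: "prod_list (map (\<lambda>y. letter (bvec y)) w) = bvec w"
  by (induction w) (simp_all add: bvec_Nil bvec_append)

lemma star_word_split:
  "star_word br (w @ t # z) (bvec a) =
    dec2 a (\<lambda>p r. dec2 r (\<lambda>q s. star_word br w (bvec p) * letter (br (bvec t) (bvec q)) * star_word br z (bvec s)))"
proof (induction w arbitrary: a)
  case Nil
  show ?case by simp
next
  case (Cons v w)
  let ?l = "\<lambda>t a. letter (br (bvec t) (bvec a))"
  let ?S = "\<lambda>w a. star_word br w (bvec a)"
  have "?S ((v # w) @ t # z) a = dec2 a (\<lambda>a1 r. dec2 r (\<lambda>a2 a3. dec2 a3 (\<lambda>p r. dec2 r (\<lambda>q s.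
      bvec a1 * ?l v a2 * ?S w p * ?l t q * ?S z s))))"
    by (simp add: Cons dec2_def sum_distrib_left case_prod_unfold mult.assoc)
  also have "\<dots> = dec2 a (\<lambda>a1 r. dec2 r (\<lambda>p' r'. dec2 p' (\<lambda>a2 p. dec2 r' (\<lambda>q s.
      bvec a1 * ?l v a2 * ?S w p * ?l t q * ?S z s))))"
    by (subst (2) dec2_assoc) simp
  also have "\<dots> = dec2 a (\<lambda>b r'. dec2 b (\<lambda>a1 p'. dec2 p' (\<lambda>a2 p. dec2 r' (\<lambda>q s.
      bvec a1 * ?l v a2 * ?S w p * ?l t q * ?S z s))))"
    by (subst dec2_assoc) simp
  also have "\<dots> = dec2 a (\<lambda>b r'. dec2 b (\<lambda>a1 p'. dec2 r' (\<lambda>q s. dec2 p' (\<lambda>a2 p. 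
      bvec a1 * ?l v a2 * ?S w p * ?l t q * ?S z s))))"
    by (subst (3) dec2_swap) simp
  also have "\<dots> = dec2 a (\<lambda>b r'. dec2 r' (\<lambda>q s. dec2 b (\<lambda>a1 p'. dec2 p' (\<lambda>a2 p. 
      bvec a1 * ?l v a2 * ?S w p * ?l t q * ?S z s))))"
    by (subst (2) dec2_swap) simp
  also have "\<dots> = dec2 a (\<lambda>p r. dec2 r (\<lambda>q s. ?S (v # w) p * ?l t q * ?S z s))"
    by (simp add: dec2_def sum_distrib_right case_prod_unfold)
  finally show ?case .
qed

lemma star_split:
  assumes br: "bilin br"
  shows "star br (P * letter T * Z) A =
    sweedler3 A (\<lambda>A1 A2 A3. star br P A1 * letter (br T A2) * star br Z A3)"
proof -
  note li = lin_sweedler3_param lin_sweedler3 lin_mult_left lin_mult_right bilin_left[OF br] lin_ident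
    bilin_left[OF bilin_star] bilin_right[OF bilin_star] lin_letter'
  have 1: "star br (bvec p * letter (bvec t) * bvec z) A =
      sweedler3 A (\<lambda>A1 A2 A3. star br (bvec p) A1 * letter (br (bvec t) A2) * star br (bvec z) A3)" for p t z
    by (rule lin_map_eqI[of "star br (bvec p * letter (bvec t) * bvec z)"])
      (auto intro!: li simp: bvec_append star_bvec star_word_split lin_star_word)
  have 2: "star br (bvec p * letter (bvec t) * Z) A =
      sweedler3 A (\<lambda>A1 A2 A3. star br (bvec p) A1 * letter (br (bvec t) A2) * star br Z A3)" for p t
    by (rule lin_map_eqI[of "\<lambda>Z. star br (bvec p * letter (bvec t) * Z) A"])
      (auto intro!: li simp: 1 simp del: letter_bvec)
  have 3: "star br (bvec p * letter T * Z) A =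
      sweedler3 A (\<lambda>A1 A2 A3. star br (bvec p) A1 * letter (br T A2) * star br Z A3)" for p
    by (rule lin_map_eqI[of "\<lambda>T. star br (bvec p * letter T * Z) A"])
      (auto intro!: li simp: 2 simp del: letter_bvec)
  show ?thesis
    by (rule lin_map_eqI[of "\<lambda>P. star br (P * letter T * Z) A"])
      (auto intro!: li simp: 3 simp del: letter_bvec)
qed

lemma sweedler2_split:
  assumes f: "bilin f"
  shows "sweedler2 (bvec a * letter T * Z) f =
    dec2 a (\<lambda>p q. f (bvec p) (bvec q * letter T * Z)) +
    sweedler2 Z (\<lambda>p q. f (bvec a * letter T * p) q)"
proof -
  note li = lin_mult_left lin_mult_right bilin_left[OF f] bilin_right[OF f] lin_ident
    lin_letter' lin_add lin_dec2 lin_compose[OF lin_sweedler2] lin_sweedler2 lin_sweedler2_param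
  have 1: "sweedler2 (bvec a * letter (bvec t) * Z) f =
    dec2 a (\<lambda>p q. f (bvec p) (bvec q * letter (bvec t) * Z)) +
    sweedler2 Z (\<lambda>p q. f (bvec a * letter (bvec t) * p) q)" for t
    by (rule lin_map_eqI[of "\<lambda>Z. sweedler2 (bvec a * letter (bvec t) * Z) f"])
      (auto intro!: li simp: bvec_append dec2_append_letter)
  show ?thesis
    by (rule lin_map_eqI[of "\<lambda>T. sweedler2 (bvec a * letter T * Z) f"])
      (auto intro!: li simp: 1 simp del: letter_bvec)
qed

lemma sweedler2_star_word:
  assumes f: "bilin f"
  shows "sweedler2 (star_word br u (bvec a)) f =
    dec2 u (\<lambda>u1 u2. dec2 a (\<lambda>a1 a2. f (star_word br u1 (bvec a1)) (star_word br u2 (bvec a2))))"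
  using f
proof (induction u arbitrary: a f)
  case Nil
  show ?case by simp
next
  case (Cons y u)
  let ?l = "\<lambda>a. letter (br (bvec y) (bvec a))"
  let ?S = "\<lambda>w a. star_word br w (bvec a)"
  have b: "bilin (\<lambda>p. f (bvec a1 * ?l a2 * p))" for a1 a2
    by (intro bilinI bilin_left[OF Cons.prems] bilin_right[OF Cons.prems] lin_mult_right lin_ident)
  have fl: "f (dec2 w g) q = dec2 w (\<lambda>a b. f (g a b) q)" for w g q
    by (rule lin_map_dec2) (rule bilin_left[OF Cons.prems lin_ident])
  have fr: "f q (dec2 w g) = dec2 w (\<lambda>a b. f q (g a b))" for w g q
    by (rule lin_map_dec2) (rule bilin_right[OF Cons.prems lin_ident])
  have "sweedler2 (?S (y # u) a) f =
      dec2 a (\<lambda>a1 r. dec2 r (\<lambda>a2 a3. sweedler2 (bvec a1 * ?l a2 * ?S u a3) f))"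
    by (simp add: lin_map_dec2[OF lin_sweedler2])
  also have "\<dots> = dec2 a (\<lambda>a1 r. dec2 r (\<lambda>a2 a3. dec2 a1 (\<lambda>p q. f (bvec p) (bvec q * ?l a2 * ?S u a3)))) +
      dec2 a (\<lambda>a1 r. dec2 r (\<lambda>a2 a3. dec2 u (\<lambda>u1 u2. dec2 a3 (\<lambda>b1 b2.
        f (bvec a1 * ?l a2 * ?S u1 b1) (?S u2 b2)))))"
    by (simp add: sweedler2_split[OF Cons.prems] Cons.IH[OF b] dec2_distrib)
  also have "dec2 a (\<lambda>a1 r. dec2 r (\<lambda>a2 a3. dec2 a1 (\<lambda>p q. f (bvec p) (bvec q * ?l a2 * ?S u a3)))) =
      dec2 a (\<lambda>a1 r. dec2 a1 (\<lambda>p q. dec2 r (\<lambda>a2 a3. f (bvec p) (bvec q * ?l a2 * ?S u a3))))"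
    by (subst (2) dec2_swap) simp
  also have "\<dots> = dec2 a (\<lambda>p r. f (bvec p) (?S (y # u) r))"
    by (simp add: dec2_assoc[symmetric] fr)
  also have "dec2 a (\<lambda>a1 r. dec2 r (\<lambda>a2 a3. dec2 u (\<lambda>u1 u2. dec2 a3 (\<lambda>b1 b2.
        f (bvec a1 * ?l a2 * ?S u1 b1) (?S u2 b2))))) =
      dec2 u (\<lambda>u1 u2. dec2 a (\<lambda>a1 r. dec2 r (\<lambda>a2 a3. dec2 a3 (\<lambda>b1 b2.
        f (bvec a1 * ?l a2 * ?S u1 b1) (?S u2 b2)))))"
    by (simp add: dec2_swap[of u])
  also have "\<dots> = dec2 u (\<lambda>u1 u2. dec2 a (\<lambda>a' b2. f (?S (y # u1) a') (?S u2 b2)))"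
    by (simp add: dec2_assoc fl)
  finally show ?case by simp
qed

lemma sweedler3_star_word:
  assumes f1: "\<And>q s. lin_map (\<lambda>p. f p q s)"
    and f2: "\<And>p s. lin_map (\<lambda>q. f p q s)"
    and f3: "\<And>p q. lin_map (\<lambda>s. f p q s)"
  shows "sweedler3 (star_word br u (bvec a)) f =
    dec2 u (\<lambda>u1 v. dec2 v (\<lambda>u2 u3. dec2 a (\<lambda>a1 r. dec2 r (\<lambda>a2 a3.
      f (star_word br u1 (bvec a1)) (star_word br u2 (bvec a2)) (star_word br u3 (bvec a3))))))"
proof -
  have b1: "bilin (\<lambda>p r. sweedler2 r (f p))"
    by (intro bilinI lin_sweedler2 lin_sweedler2_param f1)
  have b2: "bilin (f p)" for p
    by (intro bilinI f2 f3)
  show ?thesis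
    by (simp add: sweedler3_eq sweedler2_star_word[OF b1] sweedler2_star_word[OF b2])
      (subst (2) dec2_swap, simp)
qed

lemma star_word_assoc:
  assumes br: "bilin br"
    and u: "\<And>t w a. t \<in> set u \<Longrightarrow> br (br (bvec t) (bvec w)) (bvec a) = br (bvec t) (star_word br w (bvec a))"
  shows "star br (star_word br u (bvec w)) (bvec a) = star_word br u (star_word br w (bvec a))"
  using u
proof (induction u arbitrary: w a)
  case Nil
  show ?case by (simp add: star_bvec)
next
  case (Cons y u)
  let ?S = "\<lambda>w a. star_word br w (bvec a)"
  have st: "star br (dec2 v g) A = dec2 v (\<lambda>a b. star br (g a b) A)" for v g A
    by (rule lin_map_dec2) (rule bilin_left[OF bilin_star lin_ident])
  have "star br (?S (y # u) w) (bvec a) =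
    dec2 w (\<lambda>w1 v. dec2 v (\<lambda>w2 w3. dec2 a (\<lambda>a1 r. dec2 r (\<lambda>a2 a3.
      ?S w1 a1 * letter (br (br (bvec y) (bvec w2)) (bvec a2)) * star br (?S u w3) (bvec a3)))))"
    by (simp add: st star_split[OF br] star_bvec)
  also have "\<dots> = dec2 w (\<lambda>w1 v. dec2 v (\<lambda>w2 w3. dec2 a (\<lambda>a1 r. dec2 r (\<lambda>a2 a3.
      ?S w1 a1 * letter (br (bvec y) (?S w2 a2)) * star_word br u (?S w3 a3)))))"
    by (simp add: Cons.prems Cons.IH)
  also have "\<dots> = sweedler3 (?S w a) (\<lambda>A1 A2 A3. A1 * letter (br (bvec y) A2) * star_word br u A3)"
    by (rule sweedler3_star_word[symmetric])
      (intro lin_mult_left lin_mult_right lin_ident lin_letter' bilin_right[OF br] lin_star_word)+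
  finally show ?case by simp
qed

lemma lin_brace_forest:
  "lin_map (brace_forest G :: ('x pforest \<Rightarrow>\<^sub>0 'k) \<Rightarrow> ('x pforest \<Rightarrow>\<^sub>0 'k::comm_ring_1))"
proof (cases G)
  case Nil
  then have "(brace_forest G :: ('x pforest \<Rightarrow>\<^sub>0 'k) \<Rightarrow> _) = (\<lambda>A. A)" by (intro ext) simp
  then show ?thesis by (simp add: lin_ident)
next
  case (Cons Y Ys)
  then have "(brace_forest G :: ('x pforest \<Rightarrow>\<^sub>0 'k) \<Rightarrow> _) =
      (\<lambda>A. sweedler3 A (\<lambda>A1 A2 A3. A1 * letter (brace_tree Y A2) * brace_forest Ys A3))"
    by (intro ext) simp
  then show ?thesis by (simp add: lin_sweedler3)
qed

lemma lin_brace_tree: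
  "lin_map (brace_tree T :: ('x pforest \<Rightarrow>\<^sub>0 'k) \<Rightarrow> ('x ptree \<Rightarrow>\<^sub>0 'k::comm_ring_1))"
proof (cases T)
  case (Node x Ys)
  then have "(brace_tree T :: ('x pforest \<Rightarrow>\<^sub>0 'k) \<Rightarrow> _) = (\<lambda>A. Bplus x (brace_forest Ys A))" by (intro ext) simp
  then show ?thesis by (simp add: lin_compose[OF lin_Bplus lin_brace_forest])
qed

lemma bilin_brace: "bilin brace"
  unfolding brace_def by (intro bilinI lin_linext lin_linext_param lin_brace_tree)

lemma brace_bvec: "brace (bvec T) A = brace_tree T A"
  by (simp add: brace_def)

lemma brace_forest_eq: "brace_forest G A = star_word brace G A"
  by (induction G arbitrary: A) (simp_all add: brace_bvec)

lemma brace_Bplus: "brace (Bplus x G) A = Bplus x (star brace G A)"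
  by (rule lin_map_eqI[of "\<lambda>G. brace (Bplus x G) A"])
    (auto intro!: bilin_left[OF bilin_brace] bilin_left[OF bilin_star] lin_Bplus lin_compose[OF lin_Bplus] lin_ident
      simp: brace_bvec brace_forest_eq star_bvec)

lemma brace_brace_bvec:
  "brace (brace (bvec T) (bvec w)) (bvec a) =
    (brace (bvec T) (star_word brace w (bvec a)) :: 'x ptree \<Rightarrow>\<^sub>0 'k::comm_ring_1)"
proof (induction T arbitrary: w a)
  case (Node x Ys)
  have "brace (brace (bvec (Node x Ys)) (bvec w)) (bvec a) =
      (Bplus x (star brace (star_word brace Ys (bvec w)) (bvec a)) :: 'x ptree \<Rightarrow>\<^sub>0 'k)"
    by (simp add: brace_bvec brace_Bplus brace_forest_eq)
  also have "\<dots> = Bplus x (star_word brace Ys (star_word brace w (bvec a)))"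
    by (rule arg_cong[OF star_word_assoc[OF bilin_brace Node]])
  finally show ?case
    by (simp add: brace_bvec brace_forest_eq)
qed

lemma brace_brace: "brace (brace Y W) A = brace Y (star brace W A)"
proof -
  note li = bilin_left[OF bilin_brace] bilin_right[OF bilin_brace] bilin_left[OF bilin_star]
    bilin_right[OF bilin_star] lin_ident
  have 1: "brace (brace (bvec T) (bvec w)) A = brace (bvec T) (star brace (bvec w) A)" for T w
    by (rule lin_map_eqI[of "brace (brace (bvec T) (bvec w))"])
      (intro li | simp add: brace_brace_bvec star_bvec)+
  have 2: "brace (brace (bvec T) W) A = brace (bvec T) (star brace W A)" for T
    by (rule lin_map_eqI[of "\<lambda>W. brace (brace (bvec T) W) A"]) (intro li | simp add: 1)+
  show ?thesis
    by (rule lin_map_eqI[of "\<lambda>Y. brace (brace Y W) A"]) (intro li | simp add: 2)+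
qed

lemma star_word_unit:
  assumes "\<And>t. t \<in> set u \<Longrightarrow> br (bvec t) 1 = bvec t"
  shows "star_word br u 1 = bvec u"
proof -
  have "star_word br u (bvec []) = bvec u"
    using assms by (induction u) (simp_all add: bvec_Nil[symmetric] bvec_append)
  then show ?thesis by (simp add: bvec_Nil)
qed

lemma brace_unit:
  fixes Y :: "'x ptree \<Rightarrow>\<^sub>0 'k::comm_ring_1"
  shows "brace Y 1 = Y"
proof -
  have 1: "brace (bvec T) 1 = (bvec T :: 'x ptree \<Rightarrow>\<^sub>0 'k)" for T
  proof (induction T)
    case (Node x Ys)
    then have "star_word brace Ys 1 = (bvec Ys :: 'x pforest \<Rightarrow>\<^sub>0 'k)"
      by (intro star_word_unit)
    then show ?case by (simp add: brace_bvec brace_forest_eq)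
  qed
  show ?thesis
    by (rule lin_map_eqI[of "\<lambda>Y. brace Y 1"]) (intro bilin_left[OF bilin_brace] lin_ident | simp add: 1)+
qed

theorem brace_algebra_brace: "brace_algebra brace"
  using bilin_brace
  by (simp add: brace_algebra_def bilin_def brace_unit brace_brace brace_insert_eq_star[OF bilin_brace])

theorem brace_unique:
  "brace_algebra br \<and> (\<forall>x G. br (bvec (Node x [])) G = Bplus x G) \<longleftrightarrow> br = brace"
proof safe
  assume br: "brace_algebra br" and gen: "\<forall>x G. br (bvec (Node x [])) G = Bplus x G"
  have b: "bilin br" using br by (simp add: brace_algebra_def bilin_def)
  have ax: "br (br Y (prod_list (map letter Ys))) A = br Y (brace_insert br Ys A)" for Y Ys A
    using br by (simp add: brace_algebra_def)
  have tree: "br (bvec T) A = brace_tree T A" for T A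
  proof (induction T arbitrary: A)
    case (Node x Ys)
    have "star_word br Ys A = brace_forest Ys A" for A
      using Node by (induction Ys arbitrary: A) simp_all
    then show ?case
      using ax[of "bvec (Node x [])" "map bvec Ys" A]
      by (simp add: gen brace_insert_eq_star[OF b] prod_list_letters star_bvec comp_def
          del: letter_bvec)
  qed
  show "br = brace"
  proof (intro ext)
    fix Y A
    show "br Y A = brace Y A"
      by (rule lin_map_eqI[of "\<lambda>Y. br Y A"])
        (intro bilin_left[OF b] bilin_left[OF bilin_brace] lin_ident | simp add: tree brace_bvec)+
  qed
next
  show "brace_algebra brace" by (rule brace_algebra_brace)
next
  fix x G
  show "brace (bvec (Node x [])) G = Bplus x G" by (simp add: brace_bvec)
qed


section \<open>Foissy's coproduct\<close>

theorem foissy_unique: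
  "lin_map D \<and> D 1 = 1 \<and> (\<forall>A B. D (A * B) = D A * D B) \<and>
    (\<forall>x G. D (letter (Bplus x (bvec G))) = tens (letter (Bplus x (bvec G))) 1 +
        tens_map id (\<lambda>V. letter (Bplus x V)) (D (bvec G)))
    \<longleftrightarrow> D = foissy"
proof (intro iffI conjI allI)
  assume *: "lin_map D \<and> D 1 = 1 \<and> (\<forall>A B. D (A * B) = D A * D B) \<and>
    (\<forall>x G. D (letter (Bplus x (bvec G))) = tens (letter (Bplus x (bvec G))) 1 +
        tens_map id (\<lambda>V. letter (Bplus x V)) (D (bvec G)))"
  then have one: "D 1 = 1" and mult: "D (A * B) = D A * D B" for A B by blast+
  have "D (bvec [T]) = foissy_tree T" and forest: "D (bvec G) = foissy_forest G" for T G
  proof (induction T and G rule: foissy_tree_foissy_forest.induct)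
    case (1 x G)
    have "D (letter (Bplus x (bvec G))) = tens (letter (Bplus x (bvec G))) 1 +
        tens_map id (\<lambda>V. letter (Bplus x V)) (D (bvec G))"
      using * by blast
    then show ?case using 1 by simp
  next
    case 2
    show ?case using one by (simp add: bvec_Nil)
  next
    case (3 T G)
    then show ?case using mult[of "bvec [T]" "bvec G"] by (simp add: bvec_append)
  qed
  show "D = foissy"
  proof (rule ext, rule lin_map_eqI[of D])
    show "lin_map D" using * by blast
    show "lin_map foissy" unfolding foissy_def by (rule lin_linext)
    show "D (bvec G) = foissy (bvec G)" for G by (simp add: forest foissy_def)
  qed
next
  assume D: "D = foissy"
  have l: "lin_map foissy" unfolding foissy_def by (rule lin_linext)
  have app: "foissy_forest (u @ v) = foissy_forest u * foissy_forest v" for u v :: "'x pforest"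
    by (induction u) (simp_all add: mult.assoc)
  show "lin_map D" by (simp add: D l)
  show "D 1 = 1" by (simp add: D foissy_def bvec_Nil[symmetric])
  show "D (A * B) = D A * D B" for A B
  proof -
    have 1: "foissy (bvec u * B) = foissy (bvec u) * foissy B" for u
      by (rule lin_map_eqI[of "\<lambda>B. foissy (bvec u * B)"])
        (intro lin_compose[OF l] lin_mult_right lin_ident l | simp add: bvec_append, simp add: foissy_def app)+
    have "foissy (A * B) = foissy A * foissy B"
      by (rule lin_map_eqI[of "\<lambda>A. foissy (A * B)"])
        (intro lin_compose[OF l] lin_mult_left lin_ident l | simp add: 1)+
    then show ?thesis by (simp add: D)
  qed
  show "D (letter (Bplus x (bvec G))) = tens (letter (Bplus x (bvec G))) 1 +
        tens_map id (\<lambda>V. letter (Bplus x V)) (D (bvec G))" for x G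
    by (simp add: D foissy_def)
qed

end

(* On basis elements the identity says that the coefficient of F in w * a equals the coefficient of
   (a, w) in the coproduct of F. Both coefficients vanish at the empty forest unless a and w are empty,
   and both satisfy the same recursion at F = B_x(H) G, namely
     c(a, w; B_x(H) G) = [a = B_x(H) a'] c(a', w; G)
        + [w = B_x(u) v] (sum over a = a' a'' of c(a', u; H) c(a'', v; G)).
   For the coproduct this is multiplicativity together with the cocycle equation; for the product * it
   comes from splitting off the first letter of the result, which is either the first letter of a or
   the tree obtained by inserting a prefix of a into the first letter of w. *)

theory Submission
  imports Defs
begin

section \<open>Coefficients\<close>

lemma lookup_bvec: "Poly_Mapping.lookup (bvec b) c = (if b = c then 1 else 0)"
  by (simp add: bvec_def lookup_single when_def)

lemma lookup_linext:
  "Poly_Mapping.lookup (linext f p) c =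
    (\<Sum>b\<in>Poly_Mapping.keys p. Poly_Mapping.lookup p b * Poly_Mapping.lookup (f b) c)"
  by (simp add: linext_def lookup_sum lookup_scal)

text \<open>Only the fibre of \<open>f\<close> over \<open>g c\<close> contributes, and it is a
  single point. Two maps are allowed so that \<open>f = Node x\<close> can be compared with
  \<open>g = Node y\<close>.\<close>

lemma lookup_linext_bvec_inj:
  assumes "\<And>b. f b = g c \<longleftrightarrow> b = c"
  shows "Poly_Mapping.lookup (linext (\<lambda>b. bvec (f b)) p) (g c) = Poly_Mapping.lookup p c"
  by (simp add: lookup_linext lookup_bvec assms if_distrib[of "(*) _"] in_keys_iff cong: if_cong)

lemma lookup_letter_Nil [simp]: "Poly_Mapping.lookup (letter p) [] = 0"
  by (simp add: letter_def lookup_linext lookup_bvec)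

lemma lookup_letter_Cons:
  "Poly_Mapping.lookup (letter p) (t # w) = (if w = [] then Poly_Mapping.lookup p t else 0)"
  using lookup_linext_bvec_inj[of "\<lambda>b. [b]" "\<lambda>b. [b]" t p]
  by (auto simp: letter_def lookup_linext lookup_bvec)

lemma lookup_Bplus:
  "Poly_Mapping.lookup (Bplus x p) (Node y G) = (if x = y then Poly_Mapping.lookup p G else 0)"
  using lookup_linext_bvec_inj[of "Node x" "Node y" G p]
  by (auto simp: Bplus_def lookup_linext lookup_bvec)

lemma lookup_one_list: "Poly_Mapping.lookup 1 w = (if w = [] then 1 else 0)"
  by (simp add: lookup_one zero_list_def)

lemma lookup_one_pair: "Poly_Mapping.lookup 1 (u, v) = (if u = [] \<and> v = [] then 1 else 0)"
  for u :: "'a list" and v :: "'b list"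
  by (simp add: lookup_one zero_prod_def zero_list_def)

text \<open>Expand both factors in the basis. Finiteness allows a sum over all decompositions of
  \<open>w\<close>, independent of the supports of \<open>p\<close> and \<open>q\<close>.\<close>

lemma lookup_times_splits:
  fixes p q :: "'b::monoid_add \<Rightarrow>\<^sub>0 'k::comm_ring_1"
  assumes "finite {(a, b). a + b = w}"
  shows "Poly_Mapping.lookup (p * q) w =
    (\<Sum>(a, b)\<in>{(a, b). a + b = w}. Poly_Mapping.lookup p a * Poly_Mapping.lookup q b)"
proof -
  let ?K = "Poly_Mapping.keys p \<times> Poly_Mapping.keys q"
  have "p * q = linext bvec p * linext bvec q"
    by (simp add: linext_bvec_id)
  also have "\<dots> = (\<Sum>(a, b)\<in>?K.
      scal (Poly_Mapping.lookup p a * Poly_Mapping.lookup q b) (bvec (a + b)))"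
    by (simp add: linext_def sum_product scal_mult_left scal_mult_right bvec_mult
        sum.cartesian_product mult.commute[of "Poly_Mapping.lookup q _"])
  finally have "Poly_Mapping.lookup (p * q) w =
      (\<Sum>(a, b)\<in>?K. if a + b = w then Poly_Mapping.lookup p a * Poly_Mapping.lookup q b else 0)"
    by (auto simp: lookup_sum lookup_scal lookup_bvec case_prod_unfold intro!: sum.cong)
  also have "\<dots> = (\<Sum>(a, b)\<in>?K \<inter> {(a, b). a + b = w}.
      Poly_Mapping.lookup p a * Poly_Mapping.lookup q b)"
    by (subst sum.inter_restrict) (auto intro!: sum.cong)
  also have "\<dots> = (\<Sum>(a, b)\<in>{(a, b). a + b = w}. Poly_Mapping.lookup p a * Poly_Mapping.lookup q b)"
    by (rule sum.mono_neutral_left[OF assms]) (auto simp: in_keys_iff)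
  finally show ?thesis .
qed

lemma lookup_times_list:
  fixes p q :: "'b list \<Rightarrow>\<^sub>0 'k::comm_ring_1"
  shows "Poly_Mapping.lookup (p * q) w =
    dec2 w (\<lambda>a b. Poly_Mapping.lookup p a * Poly_Mapping.lookup q b)"
  using lookup_times_splits[of w p q] finite_splits[of w] by (simp add: dec2_def plus_list_def)

text \<open>Splitting a pair means splitting each component. The second word is split outermost: in
  the coproduct it is pinned down first, leaving a sum over splittings of the first word as in the
  product \<open>*\<close>.\<close>

lemma lookup_times_list_pair:
  fixes p q :: "'a list \<times> 'b list \<Rightarrow>\<^sub>0 'k::comm_ring_1"
  shows "Poly_Mapping.lookup (p * q) (u, v) =
    dec2 v (\<lambda>c d. dec2 u (\<lambda>a b. Poly_Mapping.lookup p (a, c) * Poly_Mapping.lookup q (b, d)))"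
proof -
  let ?S = "{(c, d). c @ d = v} \<times> {(a, b). a @ b = u}"
  let ?f = "\<lambda>((c, d), (a, b)). ((a, c), (b, d))"
  have eq: "{(a, b). a + b = (u, v)} = ?f ` ?S"
    by (auto simp: plus_list_def image_iff plus_prod_def)
  have inj: "inj_on ?f ?S"
    by (auto simp: inj_on_def)
  have "finite {(a, b). a + b = (u, v)}"
    unfolding eq by (intro finite_imageI finite_cartesian_product finite_splits)
  then have "Poly_Mapping.lookup (p * q) (u, v) =
      (\<Sum>(a, b)\<in>?f ` ?S. Poly_Mapping.lookup p a * Poly_Mapping.lookup q b)"
    by (simp only: lookup_times_splits eq)
  also have "\<dots> = (\<Sum>((c, d), (a, b))\<in>?S.
      Poly_Mapping.lookup p (a, c) * Poly_Mapping.lookup q (b, d))"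
    by (subst sum.reindex[OF inj]) (simp add: case_prod_unfold comp_def)
  finally show ?thesis
    by (simp add: dec2_def sum.cartesian_product case_prod_unfold)
qed

text \<open>Serves products whose left factor is concentrated on short words, where a single
  splitting survives.\<close>

lemma dec2_left_Nil:
  assumes "\<And>a b. a \<noteq> [] \<Longrightarrow> f a b = 0"
  shows "dec2 w f = f [] w"
  by (cases w) (simp_all add: assms dec2_zero)

lemma lookup_letter_times_Nil: "Poly_Mapping.lookup (letter p * q) [] = 0"
  by (simp add: lookup_times_list)

lemma lookup_letter_times_Cons:
  "Poly_Mapping.lookup (letter p * q) (t # w) = Poly_Mapping.lookup p t * Poly_Mapping.lookup q w"
  by (simp add: lookup_times_list lookup_letter_Cons dec2_left_Nil)

lemma lookup_dec2:
  "Poly_Mapping.lookup (dec2 w f) c = dec2 w (\<lambda>a b. Poly_Mapping.lookup (f a b) c)"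
  by (simp add: dec2_def lookup_sum case_prod_unfold)


section \<open>The recursion for the product\<close>

lemma star_word_Cons_bvec_Nil:
  "star_word br (y # w) (bvec []) = letter (br (bvec y) (bvec [])) * star_word br w (bvec [])"
  by simp (simp add: bvec_Nil)

text \<open>Sort the Sweedler terms by whether the part before the first brace is empty. If not, it
  starts with \<open>t\<close>, which factors out; every summand then begins with an explicit
  letter.\<close>

lemma star_word_Cons_bvec_Cons:
  "star_word br (y # w) (bvec (t # a)) =
    letter (bvec t) * star_word br (y # w) (bvec a) +
    dec2 (t # a) (\<lambda>a2 a3. letter (br (bvec y) (bvec a2)) * star_word br w (bvec a3))"
proof -
  have "star_word br (y # w) (bvec (t # a)) =
      dec2 (t # a) (\<lambda>a2 a3. bvec [] * letter (br (bvec y) (bvec a2)) * star_word br w (bvec a3)) +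
      dec2 a (\<lambda>a1 r. dec2 r (\<lambda>a2 a3.
        bvec [t] * bvec a1 * letter (br (bvec y) (bvec a2)) * star_word br w (bvec a3)))"
    by (simp add: bvec_append)
  then show ?thesis
    by (simp add: bvec_Nil mult.assoc lin_map_dec2[OF lin_mult_right[OF lin_ident]] add.commute
        del: dec2_Cons)
qed

text \<open>Inserting into a tree keeps its root color and acts on its branches by \<open>*\<close>,
  so the recursion stays within coefficients of \<open>star_word\<close>.\<close>

lemma lookup_brace_bvec:
  "Poly_Mapping.lookup (brace (bvec (Node y u)) A) (Node z H) =
    (if y = z then Poly_Mapping.lookup (star_word brace u A) H else 0)"
  by (simp add: brace_bvec brace_forest_eq lookup_Bplus)

text \<open>If \<open>w\<close> is nonempty, each summand of the product begins with a letter and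
  has no constant term.\<close>

lemma lookup_star_word_Nil:
  "Poly_Mapping.lookup (star_word br w (bvec a)) [] = (if w = [] \<and> a = [] then 1 else 0)"
proof (cases w)
  case Nil
  then show ?thesis by (simp add: lookup_bvec)
next
  case (Cons y v)
  then show ?thesis
    by (cases a) (simp_all add: star_word_Cons_bvec_Nil star_word_Cons_bvec_Cons lookup_add
        lookup_dec2 lookup_letter_times_Nil dec2_zero del: star_word.simps(2) dec2_Cons letter_bvec)
qed

lemma lookup_star_word_Cons:
  "Poly_Mapping.lookup (star_word brace w (bvec a)) (Node z H # G) =
    (case a of [] \<Rightarrow> 0 | t # a' \<Rightarrow>
      if t = Node z H then Poly_Mapping.lookup (star_word brace w (bvec a')) G else 0) +
    (case w of [] \<Rightarrow> 0 | Node y u # v \<Rightarrow>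
      if y = z then dec2 a (\<lambda>a1 a2. Poly_Mapping.lookup (star_word brace u (bvec a1)) H *
        Poly_Mapping.lookup (star_word brace v (bvec a2)) G) else 0)"
proof (cases w)
  case Nil
  then show ?thesis by (cases a) (auto simp: lookup_bvec)
next
  case (Cons y' v)
  obtain y u where "y' = Node y u" by (cases y')
  \<comment> \<open>\<open>dec2_Cons\<close> stays off so that the sum over splittings of
    \<open>a\<close> remains folded, as in the recursion for the coproduct.\<close>
  with Cons show ?thesis
    by (cases a) (simp_all add: star_word_Cons_bvec_Nil star_word_Cons_bvec_Cons lookup_add lookup_bvec
        lookup_dec2 lookup_letter_times_Cons lookup_brace_bvec dec2_zero
        del: star_word.simps(2) dec2_Cons letter_bvec)
qed


section \<open>The recursion for the coproduct\<close>

lemma lookup_tens_letter: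
  "Poly_Mapping.lookup (tens (bvec [T]) 1) (a, w) = (if a = [T] \<and> w = [] then 1 else 0)"
  by (simp add: lookup_tens lookup_bvec lookup_one_list)

lemma tens_bvec: "tens (bvec u) (bvec v) = bvec (u, v)"
  by (simp add: tens_def)

text \<open>Puts the cocycle operator in the form of an injection of bases, whose coefficients can
  be read off directly.\<close>

lemma tens_map_letter_Bplus:
  "tens_map id (\<lambda>V. letter (Bplus x V)) Q = linext (\<lambda>p. bvec (fst p, [Node x (snd p)])) Q"
  by (simp add: tens_map_def tens_bvec case_prod_unfold)

lemma lookup_tens_map_Nil:
  "Poly_Mapping.lookup (tens_map id (\<lambda>V. letter (Bplus x V)) Q) (a, []) = 0"
  by (simp add: tens_map_letter_Bplus lookup_linext lookup_bvec)

lemma lookup_tens_map_Cons: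
  "Poly_Mapping.lookup (tens_map id (\<lambda>V. letter (Bplus x V)) Q) (a, Node y u # v) =
    (if y = x \<and> v = [] then Poly_Mapping.lookup Q (a, u) else 0)"
proof (cases "y = x \<and> v = []")
  case True
  then show ?thesis
    using lookup_linext_bvec_inj[of "\<lambda>p. (fst p, [Node x (snd p)])"
        "\<lambda>p. (fst p, [Node x (snd p)])" "(a, u)" Q]
    by (auto simp: tens_map_letter_Bplus prod_eq_iff)
next
  case False
  then show ?thesis
    by (auto simp: tens_map_letter_Bplus lookup_linext lookup_bvec)
qed

lemma dec2_single_Nil:
  assumes "\<And>a b. a \<noteq> [T] \<Longrightarrow> f a b = 0"
  shows "dec2 w f = (case w of [] \<Rightarrow> 0 | t # w' \<Rightarrow> if t = T then f [T] w' else 0)"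
  by (cases w) (auto simp: assms dec2_left_Nil)

lemma lookup_foissy_forest_Cons:
  "Poly_Mapping.lookup (foissy_forest (Node z H # G)) (a, w) =
    (case a of [] \<Rightarrow> 0 | t # a' \<Rightarrow>
      if t = Node z H then Poly_Mapping.lookup (foissy_forest G) (a', w) else 0) +
    (case w of [] \<Rightarrow> 0 | Node y u # v \<Rightarrow>
      if y = z then dec2 a (\<lambda>a1 a2. Poly_Mapping.lookup (foissy_forest H) (a1, u) *
        Poly_Mapping.lookup (foissy_forest G) (a2, v)) else 0)"
proof -
  \<comment> \<open>The term \<open>B_z^+(H)\<close> tensor 1: it takes the first letter of
    \<open>a\<close> and nothing from \<open>w\<close>.\<close>
  have 1: "Poly_Mapping.lookup (tens (bvec [Node z H]) 1 * foissy_forest G) (a, w) =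
    (case a of [] \<Rightarrow> 0 | t # a' \<Rightarrow>
      if t = Node z H then Poly_Mapping.lookup (foissy_forest G) (a', w) else 0)"
    unfolding lookup_times_list_pair lookup_tens_letter
    by (simp add: dec2_zero dec2_single_Nil dec2_left_Nil split: list.split)
  \<comment> \<open>The cocycle term: it takes exactly one tree from \<open>w\<close> and an
    arbitrary prefix of \<open>a\<close>.\<close>
  have 2: "Poly_Mapping.lookup
      (tens_map id (\<lambda>V. letter (Bplus z V)) (foissy_forest H) * foissy_forest G) (a, w) =
    (case w of [] \<Rightarrow> 0 | Node y u # v \<Rightarrow>
      if y = z then dec2 a (\<lambda>a1 a2. Poly_Mapping.lookup (foissy_forest H) (a1, u) *
        Poly_Mapping.lookup (foissy_forest G) (a2, v)) else 0)"
  proof (cases w)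
    case Nil
    then show ?thesis
      by (simp add: lookup_times_list_pair lookup_tens_map_Nil dec2_zero)
  next
    case (Cons y' v)
    obtain y u where "y' = Node y u" by (cases y')
    with Cons show ?thesis
      by (simp add: lookup_times_list_pair lookup_tens_map_Nil lookup_tens_map_Cons dec2_zero
          dec2_left_Nil)
  qed
  show ?thesis
    by (simp add: distrib_right lookup_add 1 2)
qed

lemma lookup_star_word_eq_lookup_foissy_forest:
  "Poly_Mapping.lookup (star_word brace w (bvec a)) F =
    (Poly_Mapping.lookup (foissy_forest F) (a, w) :: 'k::comm_ring_1)"
\<comment> \<open>The recursion descends both to the tail and to the branches of the first tree;
  this measure drops in either case. The words \<open>a\<close> and \<open>w\<close> change along
  the way.\<close>
proof (induction "size_list size F" arbitrary: F a w rule: less_induct)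
  case less
  show ?case
  proof (cases F)
    case Nil
    then show ?thesis by (auto simp: lookup_star_word_Nil lookup_one_pair)
  next
    case (Cons T G)
    obtain z H where T: "T = Node z H" by (cases T)
    have "Poly_Mapping.lookup (star_word brace w (bvec a)) E =
        (Poly_Mapping.lookup (foissy_forest E) (a, w) :: 'k)"
      if "E = G \<or> E = H" for E a w
      using that by (intro less.hyps) (auto simp: Cons T)
    then show ?thesis
      unfolding Cons T lookup_star_word_Cons lookup_foissy_forest_Cons
      by (simp split: list.split ptree.split del: star_word.simps)
  qed
qed


section \<open>Duality\<close>

lemma pairing_superset:
  assumes "finite S" "Poly_Mapping.keys p \<subseteq> S"
  shows "pairing p q = (\<Sum>b\<in>S. Poly_Mapping.lookup p b * Poly_Mapping.lookup q b)"
  unfolding pairing_def using assms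
  by (intro sum.mono_neutral_left) (auto simp: in_keys_iff)

text \<open>The definition sums over the support of the first argument; symmetry lets the sum run
  over the support of \<open>F\<close> instead of that of the product.\<close>

lemma pairing_commute: "pairing p q = pairing q p"
  using pairing_superset[of "Poly_Mapping.keys p \<union> Poly_Mapping.keys q" p q]
    pairing_superset[of "Poly_Mapping.keys p \<union> Poly_Mapping.keys q" q p]
  by (simp add: mult.commute)

text \<open>Here \<open>Q\<close> need not be a pure tensor, as is the case for a coproduct.\<close>

lemma pairing_tens_left:
  "pairing (tens A B) Q = (\<Sum>a\<in>Poly_Mapping.keys A. \<Sum>b\<in>Poly_Mapping.keys B.
    Poly_Mapping.lookup A a * Poly_Mapping.lookup B b * Poly_Mapping.lookup Q (a, b))"
proof -
  have "Poly_Mapping.keys (tens A B) \<subseteq> Poly_Mapping.keys A \<times> Poly_Mapping.keys B"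
    by (auto simp: in_keys_iff lookup_tens)
  then have "pairing (tens A B) Q = (\<Sum>(a, b)\<in>Poly_Mapping.keys A \<times> Poly_Mapping.keys B.
    Poly_Mapping.lookup (tens A B) (a, b) * Poly_Mapping.lookup Q (a, b))"
    by (simp add: pairing_superset case_prod_unfold)
  then show ?thesis
    by (simp add: sum.cartesian_product lookup_tens)
qed

lemma lookup_star:
  "Poly_Mapping.lookup (star brace B A) f = (\<Sum>a\<in>Poly_Mapping.keys A. \<Sum>b\<in>Poly_Mapping.keys B.
    Poly_Mapping.lookup A a * Poly_Mapping.lookup B b * Poly_Mapping.lookup (foissy_forest f) (a, b))"
proof -
  \<comment> \<open>The coefficient identity concerns basis words, so \<open>A\<close> is expanded
    by linearity.\<close>
  have "star_word brace w A = linext (\<lambda>a. star_word brace w (bvec a)) A" for w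
    using lin_map_linext[OF lin_star_word, of brace w bvec A] by (simp add: linext_bvec_id)
  then have "Poly_Mapping.lookup (star brace B A) f =
      (\<Sum>b\<in>Poly_Mapping.keys B. \<Sum>a\<in>Poly_Mapping.keys A. Poly_Mapping.lookup A a *
        Poly_Mapping.lookup B b * Poly_Mapping.lookup (foissy_forest f) (a, b))"
    by (simp add: star_def lookup_linext lookup_star_word_eq_lookup_foissy_forest sum_distrib_left
        ac_simps)
  then show ?thesis
    by (simp add: sum.swap[of _ "Poly_Mapping.keys B"])
qed

theorem theorem5p1p3:
  fixes A B F :: "'x pforest \<Rightarrow>\<^sub>0 'k::comm_ring_1"
  shows "pairing (star brace B A) F = pairing (tens A B) (foissy F)"
proof -
  let ?l = Poly_Mapping.lookup
  \<comment> \<open>Both pairings become the same triple sum over the supports of \<open>A\<close>,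
    \<open>B\<close> and \<open>F\<close>.\<close>
  have "pairing (star brace B A) F = (\<Sum>f\<in>Poly_Mapping.keys F. ?l F f *
      (\<Sum>a\<in>Poly_Mapping.keys A. \<Sum>b\<in>Poly_Mapping.keys B. ?l A a * ?l B b * ?l (foissy_forest f) (a, b)))"
    by (simp add: pairing_commute[of _ F]) (simp add: pairing_def lookup_star)
  also have "\<dots> = (\<Sum>a\<in>Poly_Mapping.keys A. \<Sum>b\<in>Poly_Mapping.keys B. \<Sum>f\<in>Poly_Mapping.keys F.
      ?l F f * (?l A a * ?l B b * ?l (foissy_forest f) (a, b)))"
    by (simp add: sum_distrib_left sum.swap[of _ _ "Poly_Mapping.keys F"])
  also have "\<dots> = pairing (tens A B) (foissy F)"
    by (simp add: pairing_tens_left foissy_def lookup_linext sum_distrib_left ac_simps)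
  finally show ?thesis .
qed

end
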